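(* Let $q\equiv 3\pmod{4}$ be a prime power with $p=\operatorname{char}(\mathbb{F}_q)>3$. There exists a smooth plane curve $C$ of degree $d=\frac{q+3}{2}$ defined over $\mathbb{F}_q$ such that $C(\mathbb{F}_q)$ is a nontrivial blocking set, and $C(\mathbb{F}_q)$ contains the projective triangle $$\Delta = \{ [0:1:-s^2],\ [1:-s^2:0],\ [-s^2:0:1] \ \mid \ s\in\mathbb{F}_q \}\subseteq\mathbb{P}^2(\mathbb{F}_q).$$
   Context: A plane curve $C=\{F=0\}\subset\mathbb{P}^2$ of degree $d$ over $\mathbb{F}_q$ is given by a nonzero homogeneous polynomial $F\in\mathbb{F}_q[x,y,z]$ of degree $d$. It is smooth if at every point $P\in C$ (over $\overline{\mathbb{F}_q}$) at least one of the partial derivatives $F_x,F_y,F_z$ does not vanish. $C(\mathbb{F}_q)$ is the set of points $[x:y:z]\in\mathbb{P}^2(\mathbb{F}_q)$ with $F(x,y,z)=0$. A set $B\subseteq\mathbb{P}^2(\mathbb{F}_q)$ is a blocking set if every line of $\mathbb{P}^2$ defined over $\mathbb{F}_q$ (an $\mathbb{F}_q$-line) contains a point of $B$; it is a nontrivial blocking set if moreover it does not contain all the $\mathbb{F}_q$-points of any $\mathbb{F}_q$-line. *)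

theory Defs
  imports
    "HOL-Analysis.Cartesian_Space"
    "HOL-Algebra.Algebraic_Closure_Type"
    "HOL-Library.Poly_Mapping"
    "HOL-Number_Theory.Cong"
begin

section \<open>Polynomials in three variables\<close>

text \<open>
  \<open>'a[x,y,z]\<close> is the monoid algebra of the exponent vectors \<open>3 \<Rightarrow>\<^sub>0 nat\<close>.  The variables \<open>x\<close>, \<open>y\<close>,
  \<open>z\<close> have the indices \<open>1\<close>, \<open>2\<close>, \<open>3\<close> of the type \<open>3\<close>, as do the coordinates of a vector in \<open>'a ^ 3\<close>.
\<close>

type_synonym 'a poly3 = "(3 \<Rightarrow>\<^sub>0 nat) \<Rightarrow>\<^sub>0 'a"

definition eval3 :: "'a::comm_semiring_1 poly3 \<Rightarrow> 'a ^ 3 \<Rightarrow> 'a" where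
  "eval3 F v = (\<Sum>m\<in>Poly_Mapping.keys F.
     Poly_Mapping.lookup F m * (\<Prod>i\<in>UNIV. (v $ i) ^ Poly_Mapping.lookup m i))"

text \<open>
  When the exponent of the variable \<open>i\<close> in \<open>m\<close> is \<open>0\<close>, the truncated exponent vector is harmless,
  since the new coefficient is \<open>0\<close>.
\<close>

definition pderiv3 :: "3 \<Rightarrow> 'a::comm_semiring_1 poly3 \<Rightarrow> 'a poly3" where
  "pderiv3 i F = (\<Sum>m\<in>Poly_Mapping.keys F.
     Poly_Mapping.single (m - Poly_Mapping.single i 1)
       (of_nat (Poly_Mapping.lookup m i) * Poly_Mapping.lookup F m))"

definition homogeneous3 :: "nat \<Rightarrow> 'a::zero poly3 \<Rightarrow> bool" where
  "homogeneous3 d F \<longleftrightarrow>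
     (\<forall>m\<in>Poly_Mapping.keys F. (\<Sum>i\<in>UNIV. Poly_Mapping.lookup m i) = d)"

section \<open>The projective plane\<close>

definition proj_rel :: "('a::field ^ 3) rel" where
  "proj_rel = {(v, w). v \<noteq> 0 \<and> (\<exists>c. c \<noteq> 0 \<and> w = c *s v)}"

lemma equiv_proj_rel: "equiv (UNIV - {0}) (proj_rel :: ('a::field ^ 3) rel)"
proof (rule equivI)
  show "(proj_rel :: ('a ^ 3) rel) \<subseteq> (UNIV - {0}) \<times> (UNIV - {0})"
    by (auto simp: proj_rel_def vec_eq_iff)
  show "refl_on (UNIV - {0}) (proj_rel :: ('a ^ 3) rel)"
    by (auto simp: refl_on_def proj_rel_def intro!: exI[of _ 1])
  show "sym (proj_rel :: ('a ^ 3) rel)"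
  proof (rule symI)
    fix v w :: "'a ^ 3"
    assume "(v, w) \<in> proj_rel"
    then obtain c where "v \<noteq> 0" "c \<noteq> 0" "w = c *s v"
      by (auto simp: proj_rel_def)
    then show "(w, v) \<in> proj_rel"
      by (auto simp: proj_rel_def vec_eq_iff intro!: exI[of _ "inverse c"])
  qed
  show "trans (proj_rel :: ('a ^ 3) rel)"
  proof (rule transI)
    fix u v w :: "'a ^ 3"
    assume "(u, v) \<in> proj_rel" "(v, w) \<in> proj_rel"
    then obtain c c' where "u \<noteq> 0" "c \<noteq> 0" "v = c *s u" "c' \<noteq> 0" "w = c' *s v"
      by (auto simp: proj_rel_def)
    then show "(u, w) \<in> proj_rel"
      by (auto simp: proj_rel_def vec_eq_iff intro!: exI[of _ "c' * c"])
  qed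
qed

definition proj_plane :: "('a::field ^ 3) set set" where
  "proj_plane = (UNIV - {0}) // proj_rel"

definition proj_point :: "'a::field \<Rightarrow> 'a \<Rightarrow> 'a \<Rightarrow> ('a ^ 3) set" where
  "proj_point x y z = proj_rel `` {vector [x, y, z]}"

text \<open>
  Here and in \<open>curve_points\<close> the equation is imposed on all representatives of a point; by
  homogeneity it holds for one of them iff it holds for all of them.
\<close>

definition proj_line :: "'a::field ^ 3 \<Rightarrow> ('a ^ 3) set set" where
  "proj_line a = {P \<in> proj_plane. \<forall>v\<in>P. (\<Sum>i\<in>UNIV. a $ i * v $ i) = 0}"

definition proj_lines :: "('a::field ^ 3) set set set" where
  "proj_lines = {proj_line a | a. a \<noteq> 0}"

definition blocking_set :: "('a::field ^ 3) set set \<Rightarrow> bool" where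
  "blocking_set B \<longleftrightarrow> B \<subseteq> proj_plane \<and> (\<forall>L\<in>proj_lines. L \<inter> B \<noteq> {})"

definition nontrivial_blocking_set :: "('a::field ^ 3) set set \<Rightarrow> bool" where
  "nontrivial_blocking_set B \<longleftrightarrow> blocking_set B \<and> (\<forall>L\<in>proj_lines. \<not> L \<subseteq> B)"

section \<open>Plane curves\<close>

definition plane_curve :: "nat \<Rightarrow> 'a::field poly3 \<Rightarrow> bool" where
  "plane_curve d F \<longleftrightarrow> F \<noteq> 0 \<and> homogeneous3 d F"

definition curve_points :: "'a::field poly3 \<Rightarrow> ('a ^ 3) set set" where
  "curve_points F = {P \<in> proj_plane. \<forall>v\<in>P. eval3 F v = 0}"

definition ac_poly3 :: "'a::field poly3 \<Rightarrow> 'a alg_closure poly3" where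
  "ac_poly3 F = Poly_Mapping.map to_ac F"

definition smooth_curve :: "'a::field poly3 \<Rightarrow> bool" where
  "smooth_curve F \<longleftrightarrow>
     (\<forall>P\<in>curve_points (ac_poly3 F). \<forall>v\<in>P. \<exists>i. eval3 (pderiv3 i (ac_poly3 F)) v \<noteq> 0)"

definition projective_triangle :: "('a::field ^ 3) set set" where
  "projective_triangle =
     (\<Union>s. {proj_point 0 1 (- s\<^sup>2), proj_point 1 (- s\<^sup>2) 0, proj_point (- s\<^sup>2) 0 1})"

end

theory Submission
  imports Defs "HOL-Number_Theory.Residues"
begin

unbundle no fps_syntax

text \<open>
  With \<open>e = (q - 1) / 2\<close> the curve is given by the sum of all \<open>x\<^sub>i\<^sup>e\<^sup>+\<^sup>1 x\<^sub>j\<close>, \<open>i \<noteq> j\<close>.  For elements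
  of the finite field, \<open>x\<^sup>e\<close> is the quadratic character.  Hence the form does not vanish at a point two
  of whose coordinates are nonzero and of the same quadratic class while the third one is not of this
  class, and every line has such a point.  A line \<open>a x + b y + c z = 0\<close> with \<open>a b c \<noteq> 0\<close> meets the
  projective triangle because one of \<open>b / c\<close>, \<open>a / b\<close>, \<open>c / a\<close>, whose product is \<open>1\<close>, is a square.

  At a singular point \<open>(x, y, z)\<close> over the closure, put \<open>\<xi> = x\<^sup>e\<close>, \<open>\<eta> = y\<^sup>e\<close>, \<open>\<zeta> = z\<^sup>e\<close>.  As
  \<open>2 (e + 1) = 1\<close> in the field, the vanishing of the partial derivatives is a linear system for
  \<open>x, y, z\<close> whose determinant \<open>6 (\<xi> + \<eta> + \<zeta>) (\<xi>\<eta> + \<eta>\<zeta> + \<zeta>\<xi>)\<close> has to vanish.  The first factor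
  leads to \<open>\<xi> = \<eta> = \<zeta> = 0\<close> directly.  If the second one vanishes, the reciprocals \<open>u, v, w\<close> of
  \<open>\<xi>, \<eta>, \<zeta>\<close> sum to \<open>0\<close> and \<open>x\<close> is proportional to \<open>u / (v - w)\<close>, cyclically.  Since
  \<open>x\<^sup>q = x / u\<^sup>2\<close>, comparison with the \<open>q\<close>-th powers yields equations between \<open>u, v, w\<close> and
  \<open>u\<^sup>q, v\<^sup>q, w\<^sup>q\<close> that are inconsistent.
\<close>

section \<open>Ternary polynomials and projective points\<close>

text \<open>Cancellation can make the keys of \<open>F + G\<close> fewer than the union of those of
  \<open>F\<close> and \<open>G\<close>; a larger index set lets all three sums run over that
  union.\<close>

lemma eval3_superset:
  assumes "finite S" "Poly_Mapping.keys F \<subseteq> S"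
  shows "eval3 F v = (\<Sum>m\<in>S. Poly_Mapping.lookup F m * (\<Prod>i\<in>UNIV. (v $ i) ^ Poly_Mapping.lookup m i))"
  unfolding eval3_def using assms by (intro sum.mono_neutral_left) (auto simp: in_keys_iff)

lemma eval3_0 [simp]: "eval3 0 v = 0"
  by (simp add: eval3_def)

lemma eval3_add: "eval3 (F + G) v = eval3 F v + eval3 G v"
proof -
  let ?S = "Poly_Mapping.keys F \<union> Poly_Mapping.keys G"
  have "eval3 H v = (\<Sum>m\<in>?S. Poly_Mapping.lookup H m * (\<Prod>i\<in>UNIV. (v $ i) ^ Poly_Mapping.lookup m i))"
    if "Poly_Mapping.keys H \<subseteq> ?S" for H
    using that by (intro eval3_superset) auto
  from this[of F] this[of G] this[of "F + G"] show ?thesis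
    using keys_add[of F G] by (simp add: lookup_add distrib_right sum.distrib)
qed

lemma eval3_single:
  "eval3 (Poly_Mapping.single m c) v = c * (\<Prod>i\<in>UNIV. (v $ i) ^ Poly_Mapping.lookup m i)"
  by (simp add: eval3_def)

lemma pderiv3_superset:
  assumes "finite S" "Poly_Mapping.keys F \<subseteq> S"
  shows "pderiv3 k F = (\<Sum>m\<in>S. Poly_Mapping.single (m - Poly_Mapping.single k 1)
     (of_nat (Poly_Mapping.lookup m k) * Poly_Mapping.lookup F m))"
  unfolding pderiv3_def using assms by (intro sum.mono_neutral_left) (auto simp: in_keys_iff)

lemma pderiv3_add: "pderiv3 k (F + G) = pderiv3 k F + pderiv3 k G"
proof -
  let ?S = "Poly_Mapping.keys F \<union> Poly_Mapping.keys G"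
  have "pderiv3 k H = (\<Sum>m\<in>?S. Poly_Mapping.single (m - Poly_Mapping.single k 1)
     (of_nat (Poly_Mapping.lookup m k) * Poly_Mapping.lookup H m))"
    if "Poly_Mapping.keys H \<subseteq> ?S" for H
    using that by (intro pderiv3_superset) auto
  from this[of F] this[of G] this[of "F + G"] show ?thesis
    using keys_add[of F G]
    by (simp add: lookup_add distrib_left single_add sum.distrib)
qed

lemma pderiv3_single:
  "pderiv3 k (Poly_Mapping.single m c) =
     Poly_Mapping.single (m - Poly_Mapping.single k 1) (of_nat (Poly_Mapping.lookup m k) * c)"
  by (simp add: pderiv3_def)

lemma ac_poly3_0 [simp]: "ac_poly3 0 = 0"
  by (simp add: ac_poly3_def map_eq_zero_iff)

lemma lookup_ac_poly3: "Poly_Mapping.lookup (ac_poly3 F) m = to_ac (Poly_Mapping.lookup F m)"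
  by (simp add: ac_poly3_def Poly_Mapping.map.rep_eq when_def)

lemma ac_poly3_add: "ac_poly3 (F + G) = ac_poly3 F + ac_poly3 G"
  by (rule poly_mapping_eqI) (simp add: lookup_ac_poly3 lookup_add)

lemma ac_poly3_sum: "ac_poly3 (\<Sum>x\<in>A. f x) = (\<Sum>x\<in>A. ac_poly3 (f x))"
  by (induction A rule: infinite_finite_induct) (simp_all add: ac_poly3_add)

section \<open>Homogeneous forms on projective classes\<close>

lemma eval3_scale:
  assumes "homogeneous3 d F"
  shows "eval3 F (c *s v) = c ^ d * eval3 F v"
  unfolding eval3_def sum_distrib_left
proof (rule sum.cong)
  fix m assume "m \<in> Poly_Mapping.keys F"
  then have "(\<Sum>i\<in>UNIV. Poly_Mapping.lookup m i) = d"
    using assms by (simp add: homogeneous3_def)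
  then show "Poly_Mapping.lookup F m * (\<Prod>i\<in>UNIV. ((c *s v) $ i) ^ Poly_Mapping.lookup m i) =
      c ^ d * (Poly_Mapping.lookup F m * (\<Prod>i\<in>UNIV. (v $ i) ^ Poly_Mapping.lookup m i))"
    by (auto simp: power_mult_distrib prod.distrib mult_ac simp flip: power_sum)
qed simp

lemma proj_class_in_plane: "v \<noteq> 0 \<Longrightarrow> proj_rel `` {v} \<in> proj_plane"
  by (simp add: proj_plane_def quotientI)

lemma proj_class_in_curve_points_iff:
  fixes F :: "'a::field poly3"
  assumes "homogeneous3 d F" "v \<noteq> 0"
  shows "proj_rel `` {v} \<in> curve_points F \<longleftrightarrow> eval3 F v = 0"
proof -
  have "(v, v) \<in> proj_rel"
    using assms by (auto simp: proj_rel_def intro!: exI[of _ 1])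
  moreover have "eval3 F w = 0" if "(v, w) \<in> proj_rel" "eval3 F v = 0" for w
    using that eval3_scale[OF assms(1)] by (auto simp: proj_rel_def)
  ultimately show ?thesis
    using proj_class_in_plane[OF assms(2)] by (auto simp: curve_points_def)
qed

lemma proj_class_in_line:
  fixes a v :: "'a::field ^ 3"
  assumes "v \<noteq> 0" "(\<Sum>i\<in>UNIV. a $ i * v $ i) = 0"
  shows "proj_rel `` {v} \<in> proj_line a"
proof -
  have "(\<Sum>i\<in>UNIV. a $ i * w $ i) = 0" if w: "(v, w) \<in> proj_rel" for w
  proof -
    obtain c where "w = c *s v"
      using w by (auto simp: proj_rel_def)
    then have "(\<Sum>i\<in>UNIV. a $ i * w $ i) = c * (\<Sum>i\<in>UNIV. a $ i * v $ i)"
      by (simp add: sum_distrib_left mult_ac)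
    then show ?thesis
      using assms by simp
  qed
  then show ?thesis
    using proj_class_in_plane[OF assms(1)] by (auto simp: proj_line_def)
qed

lemma nontrivial_blocking_set_curve_pointsI:
  fixes F :: "'a::field poly3"
  assumes F: "homogeneous3 d F"
    and meets: "\<And>a. a \<noteq> 0 \<Longrightarrow> \<exists>v. v \<noteq> 0 \<and> (\<Sum>i\<in>UNIV. a $ i * v $ i) = 0 \<and> eval3 F v = 0"
    and leaves: "\<And>a. a \<noteq> 0 \<Longrightarrow> \<exists>v. v \<noteq> 0 \<and> (\<Sum>i\<in>UNIV. a $ i * v $ i) = 0 \<and> eval3 F v \<noteq> 0"
  shows "nontrivial_blocking_set (curve_points F)"
  unfolding nontrivial_blocking_set_def blocking_set_def
proof (intro conjI ballI)
  show "curve_points F \<subseteq> proj_plane"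
    by (auto simp: curve_points_def)
  show "L \<inter> curve_points F \<noteq> {}" if "L \<in> proj_lines" for L
  proof -
    obtain a where L: "L = proj_line a" and "a \<noteq> 0"
      using \<open>L \<in> proj_lines\<close> by (auto simp: proj_lines_def)
    then obtain v where v: "v \<noteq> 0" "(\<Sum>i\<in>UNIV. a $ i * v $ i) = 0" "eval3 F v = 0"
      using meets by blast
    then show ?thesis
      using proj_class_in_line[OF v(1,2)] proj_class_in_curve_points_iff[OF F v(1)] L by blast
  qed
  show "\<not> L \<subseteq> curve_points F" if "L \<in> proj_lines" for L
  proof -
    obtain a where L: "L = proj_line a" and "a \<noteq> 0"
      using \<open>L \<in> proj_lines\<close> by (auto simp: proj_lines_def)
    then obtain v where v: "v \<noteq> 0" "(\<Sum>i\<in>UNIV. a $ i * v $ i) = 0" "eval3 F v \<noteq> 0"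
      using leaves by blast
    then show ?thesis
      using proj_class_in_line[OF v(1,2)] proj_class_in_curve_points_iff[OF F v(1)] L by blast
  qed
qed

text \<open>Turns singularity into a system of equations in the partial derivatives alone, to be
  solved over the closure.\<close>

lemma smooth_curveI:
  fixes F :: "'a::field poly3"
  assumes "\<And>v. v \<noteq> 0 \<Longrightarrow> \<exists>i. eval3 (pderiv3 i (ac_poly3 F)) v \<noteq> 0"
  shows "smooth_curve F"
  unfolding smooth_curve_def
proof (intro ballI)
  fix P :: "('a alg_closure ^ 3) set" and v
  assume "P \<in> curve_points (ac_poly3 F)" "v \<in> P"
  then have "v \<noteq> 0"
    using equiv_proj_rel in_quotient_imp_subset
    by (fastforce simp: curve_points_def proj_plane_def)
  then show "\<exists>i. eval3 (pderiv3 i (ac_poly3 F)) v \<noteq> 0"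
    by (rule assms)
qed

section \<open>The curve\<close>

text \<open>The curve takes \<open>n = (q + 1) / 2\<close>, so that the degree \<open>n + 1\<close>
  is \<open>(q + 3) / 2\<close>.\<close>

definition triangle_poly :: "nat \<Rightarrow> 'a::comm_semiring_1 poly3" where
  "triangle_poly n = (\<Sum>(i, j)\<in>{(i, j). i \<noteq> j}.
     Poly_Mapping.single (Poly_Mapping.single i n + Poly_Mapping.single j 1) 1)"

definition triangle_form :: "nat \<Rightarrow> 'a::comm_semiring_1 \<Rightarrow> 'a \<Rightarrow> 'a \<Rightarrow> 'a" where
  "triangle_form n x y z = x ^ n * (y + z) + y ^ n * (x + z) + z ^ n * (x + y)"

lemma off_diagonal_3: "{(i, j). i \<noteq> j} = {(1::3, 2::3), (1, 3), (2, 1), (2, 3), (3, 1), (3, 2)}"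
  by auto (metis exhaust_3)+

lemma prod_3: "prod f (UNIV::3 set) = f 1 * f 2 * f 3"
  unfolding UNIV_3 by (simp add: ac_simps)

lemma ac_triangle_poly: "ac_poly3 (triangle_poly n) = triangle_poly n"
  unfolding triangle_poly_def ac_poly3_sum
  by (intro sum.cong) (auto simp: ac_poly3_def)

lemma homogeneous_triangle_poly: "homogeneous3 (Suc n) (triangle_poly n)"
proof -
  let ?M = "(\<lambda>(i, j). Poly_Mapping.single i n + Poly_Mapping.single j 1) ` {(i::3, j). i \<noteq> j}"
  have "Poly_Mapping.keys (triangle_poly n) \<subseteq> ?M"
    unfolding triangle_poly_def
    by (rule order_trans[OF keys_sum]) (auto split: if_splits)
  moreover have "(\<Sum>i\<in>UNIV. Poly_Mapping.lookup m i) = Suc n" if "m \<in> ?M" for m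
    using that by (auto simp: lookup_add sum.distrib lookup_single when_def)
  ultimately show ?thesis
    unfolding homogeneous3_def by blast
qed

lemma eval_triangle_poly:
  "eval3 (triangle_poly n) v = triangle_form n (v $ 1) (v $ 2) (v $ 3)"
  unfolding triangle_poly_def off_diagonal_3 triangle_form_def
  by (simp add: eval3_add eval3_single prod_3 lookup_add lookup_single algebra_simps)

lemma eval_pderiv_triangle_poly:
  assumes "n > 0"
  shows "eval3 (pderiv3 1 (triangle_poly n)) v =
      of_nat n * (v $ 1) ^ (n - 1) * (v $ 2 + v $ 3) + (v $ 2) ^ n + (v $ 3) ^ n"
    and "eval3 (pderiv3 2 (triangle_poly n)) v =
      of_nat n * (v $ 2) ^ (n - 1) * (v $ 1 + v $ 3) + (v $ 1) ^ n + (v $ 3) ^ n"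
    and "eval3 (pderiv3 3 (triangle_poly n)) v =
      of_nat n * (v $ 3) ^ (n - 1) * (v $ 1 + v $ 2) + (v $ 1) ^ n + (v $ 2) ^ n"
  using assms unfolding triangle_poly_def off_diagonal_3
  by (simp_all add: pderiv3_add eval3_add pderiv3_single eval3_single prod_3 lookup_add
      lookup_minus lookup_single algebra_simps)

section \<open>Lines over the finite field\<close>

lemma triangle_form_commute:
  "triangle_form n x y z = triangle_form n y x z"
  "triangle_form n x y z = triangle_form n x z y"
  by (simp_all add: triangle_form_def algebra_simps)

lemma triangle_form_rotate: "triangle_form n x y z = triangle_form n y z x"
  by (simp add: triangle_form_def algebra_simps)

lemma triangle_form_0: "n > 0 \<Longrightarrow> triangle_form n 0 0 0 = 0"
  by (simp add: triangle_form_def)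

context
  fixes e :: nat
  assumes odd_e: "odd e" and card: "CARD('a::finite_field) = 2 * e + 1"
begin

text \<open>Multiplying the square of \<open>x ^ e\<close> by \<open>x\<close> gives
  \<open>x ^ q = x\<close>, and \<open>x\<close> cancels.\<close>

lemma power_half_cases:
  fixes x :: 'a
  assumes "x \<noteq> 0"
  shows "x ^ e = 1 \<or> x ^ e = - 1"
proof -
  have "x * (x ^ e)\<^sup>2 = x * 1"
    using finite_field_power_card_eq_same[of x]
    by (simp add: card power_mult[symmetric] mult.commute)
  then show ?thesis
    using assms by (simp add: power2_eq_1_iff)
qed

text \<open>Since \<open>e + 1\<close> is even, \<open>x = x ^ (e + 1)\<close> has the explicit root
  \<open>x ^ ((e + 1) div 2)\<close>.\<close>

lemma square_if_power_half_eq_1: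
  fixes x :: 'a
  assumes "x ^ e = 1"
  shows "\<exists>s. x = s\<^sup>2"
proof
  have "(e + 1) div 2 * 2 = e + 1"
    using odd_e by (auto elim!: oddE)
  then have "(x ^ ((e + 1) div 2))\<^sup>2 = x ^ (e + 1)"
    by (simp only: flip: power_mult)
  then show "x = (x ^ ((e + 1) div 2))\<^sup>2"
    using assms by simp
qed

text \<open>At \<open>(0, 1, t)\<close> the form is \<open>t + t ^ (e + 1)\<close>. For
  \<open>t = - s\<^sup>2\<close> the even exponent removes the sign, and the power is
  \<open>s ^ q * s = s\<^sup>2\<close>.\<close>

lemma triangle_form_minus_square: "triangle_form (e + 1) 0 1 (- (s :: 'a)\<^sup>2) = 0"
proof -
  have "(- s\<^sup>2) ^ (e + 1) = s ^ (2 * e + 1) * s"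
    using odd_e by (simp add: power_mult power2_eq_square power_mult_distrib mult_ac)
  then show ?thesis
    using finite_field_power_card_eq_same[of s]
    by (simp add: triangle_form_def card power2_eq_square del: power_Suc)
qed

context
  assumes char: "(2 :: 'a) \<noteq> 0" "(3 :: 'a) \<noteq> 0"
begin

lemma triangle_form_zero_on_line:
  fixes a b c :: 'a
  obtains x y z where "(x, y, z) \<noteq> (0, 0, 0)" "a * x + b * y + c * z = 0"
    "triangle_form (e + 1) x y z = 0"
proof -
  consider "a = 0" | "b = 0" | "c = 0" | "a \<noteq> 0" "b \<noteq> 0" "c \<noteq> 0"
    by blast
  then show thesis
  proof cases
    \<comment> \<open>A zero coefficient puts a vertex of the coordinate triangle on the line, and
      the form vanishes at all vertices.\<close>
    case 1
    then show thesis using that[of 1 0 0] by (simp add: triangle_form_def)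
  next
    case 2
    then show thesis using that[of 0 1 0] by (simp add: triangle_form_def)
  next
    case 3
    then show thesis using that[of 0 0 1] by (simp add: triangle_form_def)
  next
    case 4
    \<comment> \<open>Three signs with product \<open>1\<close> cannot all be
      \<open>- 1\<close>.\<close>
    have "(b / c) ^ e * (a / b) ^ e * (c / a) ^ e = 1"
      using 4 by (simp flip: power_mult_distrib)
    moreover have "(- 1 :: 'a) \<noteq> 1"
      using char by simp
    ultimately consider "(b / c) ^ e = 1" | "(a / b) ^ e = 1" | "(c / a) ^ e = 1"
      using power_half_cases[of "b / c"] power_half_cases[of "a / b"] power_half_cases[of "c / a"] 4
      by auto
    then show thesis
    proof cases
      case 1
      from square_if_power_half_eq_1[OF this] obtain s where "b / c = s\<^sup>2" ..
      with 4 have "b = c * s\<^sup>2" by (simp add: divide_eq_eq mult.commute)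
      then show thesis
        using that[of 0 1 "- s\<^sup>2"] triangle_form_minus_square[of s] by simp
    next
      case 2
      from square_if_power_half_eq_1[OF this] obtain s where "a / b = s\<^sup>2" ..
      with 4 have "a = b * s\<^sup>2" by (simp add: divide_eq_eq mult.commute)
      moreover have "triangle_form (e + 1) 1 (- s\<^sup>2) 0 = 0"
        using triangle_form_minus_square[of s] by (simp only: triangle_form_rotate[of _ 0])
      ultimately show thesis
        using that[of 1 "- s\<^sup>2" 0] by simp
    next
      case 3
      from square_if_power_half_eq_1[OF this] obtain s where "c / a = s\<^sup>2" ..
      with 4 have "c = a * s\<^sup>2" by (simp add: divide_eq_eq mult.commute)
      moreover have "triangle_form (e + 1) (- s\<^sup>2) 0 1 = 0"
        using triangle_form_minus_square[of s] by (simp only: triangle_form_rotate[of _ "- s\<^sup>2"])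
      ultimately show thesis
        using that[of "- s\<^sup>2" 0 1] by simp
    qed
  qed
qed

text \<open>The terms containing \<open>z\<close> vanish or cancel, which leaves
  \<open>2 * x * y\<close> times the common sign \<open>x ^ e\<close>.\<close>

lemma triangle_form_nonzero:
  fixes x y z :: 'a
  assumes "x \<noteq> 0" "y \<noteq> 0" "x ^ e = y ^ e" "z = 0 \<or> z ^ e = - (x ^ e)"
  shows "triangle_form (e + 1) x y z \<noteq> 0"
proof -
  have "triangle_form (e + 1) x y z = x ^ e * (2 * x * y)"
    using assms(3,4) by (auto simp: triangle_form_def algebra_simps)
  then show ?thesis
    using assms char by simp
qed

lemma triangle_form_nonzero_on_line:
  fixes a b c :: 'a
  shows "\<exists>x y z. a * x + b * y + c * z = 0 \<and> triangle_form (e + 1) x y z \<noteq> 0"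
proof -
  let ?P = "\<lambda>a b c. \<exists>x y z. a * x + b * y + c * z = 0 \<and> triangle_form (e + 1) x y z \<noteq> (0 :: 'a)"
  have swap: "?P a b c" if "?P b a c" for a b c
    using that triangle_form_commute(1) by (metis add.commute)
  have swap': "?P a b c" if "?P a c b" for a b c
    using that triangle_form_commute(2) by (metis add.commute add.assoc)
  have two_zero: "?P 0 0 c" for c
    using triangle_form_nonzero[of 1 1 0] by (intro exI[of _ 1] exI[of _ 1] exI[of _ 0]) simp
  have minus: "(- x) ^ e = - (x ^ e)" for x :: 'a
    using odd_e by (rule power_minus_odd)
  \<comment> \<open>As \<open>- 1\<close> is a non-square, \<open>b\<close> and \<open>- a\<close>
    are in the same class; \<open>(b, - a, 0)\<close> lies on the line for every
    \<open>c\<close>.\<close>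
  have mixed: "?P a b c" if "a \<noteq> 0" "b \<noteq> 0" "a ^ e \<noteq> b ^ e" for a b c
  proof -
    have "b ^ e = (- a) ^ e"
      using that power_half_cases[of a] power_half_cases[of b] by (auto simp: minus)
    then have "triangle_form (e + 1) b (- a) 0 \<noteq> 0"
      using that by (intro triangle_form_nonzero) auto
    then show ?thesis
      by (intro exI[of _ b] exI[of _ "- a"] exI[of _ 0]) simp
  qed
  have one_zero: "?P a b 0" if "a \<noteq> 0" "b \<noteq> 0" for a b
  proof (cases "a ^ e = b ^ e")
    case True
    \<comment> \<open>Now \<open>b\<close> and \<open>- a\<close> are in opposite classes. The third
      coordinate is free, and \<open>1\<close> is paired with whichever of the two is a
      square.\<close>
    have "triangle_form (e + 1) b (- a) 1 \<noteq> 0"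
    proof (cases "b ^ e = 1")
      case True
      then have "triangle_form (e + 1) b 1 (- a) \<noteq> 0"
        using that \<open>a ^ e = b ^ e\<close> by (intro triangle_form_nonzero) (auto simp: minus)
      then show ?thesis
        by (simp add: triangle_form_commute(2))
    next
      case False
      then have "triangle_form (e + 1) (- a) 1 b \<noteq> 0"
        using that \<open>a ^ e = b ^ e\<close> power_half_cases[of b]
        by (intro triangle_form_nonzero) (auto simp: minus)
      then show ?thesis
        by (metis triangle_form_commute)
    qed
    then show ?thesis
      by (intro exI[of _ b] exI[of _ "- a"] exI[of _ 1]) simp
  qed (use that mixed in blast)
  \<comment> \<open>The witnesses come from \<open>1 + 1 - 2 = 0\<close> and
    \<open>1 + 2 - 3 = 0\<close>, divided by the coefficients. If \<open>2\<close> is a square,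
    \<open>- 2 / c\<close> is opposite to \<open>1 / a\<close> and \<open>1 / b\<close>; otherwise
    \<open>1 / a\<close> and \<open>2 / b\<close> are opposite and \<open>- 3 / c\<close> joins one
    of them.\<close>
  have same: "?P a b c" if nz: "a \<noteq> 0" "b \<noteq> 0" "c \<noteq> 0" and eq: "b ^ e = a ^ e" "c ^ e = a ^ e" for a b c
  proof (cases "(2 :: 'a) ^ e = 1")
    case True
    have "triangle_form (e + 1) (1 / a) (1 / b) (- 2 / c) \<noteq> 0"
      using nz eq True by (intro triangle_form_nonzero) (auto simp: power_divide minus)
    then show ?thesis
      using nz by (intro exI[of _ "1 / a"] exI[of _ "1 / b"] exI[of _ "- 2 / c"]) simp
  next
    case False
    then have two: "(2 :: 'a) ^ e = - 1"
      using power_half_cases char by blast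
    have "triangle_form (e + 1) (1 / a) (2 / b) (- 3 / c) \<noteq> 0"
    proof (cases "(3 :: 'a) ^ e = 1")
      case True
      have "triangle_form (e + 1) (2 / b) (- 3 / c) (1 / a) \<noteq> 0"
        using nz eq True two char by (intro triangle_form_nonzero) (auto simp: power_divide minus)
      then show ?thesis
        by (metis triangle_form_commute)
    next
      case False
      then have "(3 :: 'a) ^ e = - 1"
        using power_half_cases char by blast
      then have "triangle_form (e + 1) (1 / a) (- 3 / c) (2 / b) \<noteq> 0"
        using nz eq two char by (intro triangle_form_nonzero) (auto simp: power_divide minus)
      then show ?thesis
        by (metis triangle_form_commute)
    qed
    then show ?thesis
      using nz by (intro exI[of _ "1 / a"] exI[of _ "2 / b"] exI[of _ "- 3 / c"]) simp
  qed
  consider "a = 0" "b = 0" | "a = 0" "c = 0" | "b = 0" "c = 0"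
    | "a = 0" "b \<noteq> 0" "c \<noteq> 0" | "b = 0" "a \<noteq> 0" "c \<noteq> 0" | "c = 0" "a \<noteq> 0" "b \<noteq> 0"
    | "a \<noteq> 0" "b \<noteq> 0" "c \<noteq> 0"
    by blast
  then show ?thesis
  proof cases
    case 1
    then show ?thesis using two_zero[of c] by simp
  next
    case 2
    then show ?thesis using swap'[OF two_zero[of b]] by simp
  next
    case 3
    then show ?thesis using swap[OF swap'[OF two_zero[of a]]] by simp
  next
    case 4
    then show ?thesis using swap[OF swap'[OF one_zero[of b c]]] by simp
  next
    case 5
    then show ?thesis using swap'[OF one_zero[of a c]] by simp
  next
    case 6
    then show ?thesis using one_zero[of a b] by simp
  next
    case 7
    consider "a ^ e \<noteq> b ^ e" | "a ^ e \<noteq> c ^ e" | "b ^ e = a ^ e" "c ^ e = a ^ e"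
      by metis
    then show ?thesis
    proof cases
      case 1
      then show ?thesis using mixed 7 by blast
    next
      case 2
      then show ?thesis using swap'[OF mixed[of a c b]] 7 by blast
    next
      case 3
      then show ?thesis using same 7 by blast
    qed
  qed
qed

end

end

section \<open>Smoothness\<close>

text \<open>\<open>(T + 1)\<^sup>q - T\<^sup>q - 1\<close> vanishes on the whole field with \<open>q\<close> elements, but has degree less than \<open>q\<close>.\<close>

lemma of_nat_card_choose_eq_0:
  assumes "0 < k" "k < CARD('a::finite_field)"
  shows "of_nat (CARD('a) choose k) = (0 :: 'a)"
proof -
  let ?q = "CARD('a)"
  define p :: "'a poly" where "p = (\<Sum>k\<in>{0<..<?q}. monom (of_nat (?q choose k)) k)"
  have "poly p x = 0" for x
  proof -
    have q: "{..?q} = insert 0 (insert ?q {0<..<?q})"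
      by (auto simp: Suc_le_eq)
    have "x + 1 = (x + 1) ^ ?q"
      by (simp only: finite_field_power_card_eq_same)
    also have "\<dots> = x ^ ?q + 1 + poly p x"
      unfolding binomial_ring q by (simp add: p_def poly_sum poly_monom)
    finally show ?thesis
      by (simp add: finite_field_power_card_eq_same)
  qed
  moreover have "degree p < ?q"
    unfolding p_def by (rule degree_sum_less) (auto intro: le_less_trans[OF degree_monom_le])
  ultimately have "p = 0"
    using card_poly_roots_bound[of p] by (cases "p = 0") auto
  moreover have "coeff p k = of_nat (?q choose k)"
    using assms by (simp add: p_def coeff_sum)
  ultimately show ?thesis
    by simp
qed

text \<open>Meant for the algebraic closure: the vanishing of the middle binomial coefficients is
  divisibility by the characteristic, so it transfers from the finite field.\<close>

lemma power_card_add: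
  fixes x y :: "'b::comm_semiring_1"
  assumes "CHAR('b) = CHAR('a::finite_field)"
  shows "(x + y) ^ CARD('a) = x ^ CARD('a) + y ^ CARD('a)"
proof -
  let ?q = "CARD('a)"
  have q: "{..?q} = insert 0 (insert ?q {0<..<?q})"
    by (auto simp: Suc_le_eq)
  have "of_nat (?q choose k) = (0 :: 'b)" if "k \<in> {0<..<?q}" for k
    using that of_nat_card_choose_eq_0[where ?'a = 'a, of k] assms
    by (simp add: of_nat_eq_0_iff_char_dvd)
  then have "(\<Sum>k\<in>{0<..<?q}. of_nat (?q choose k) * x ^ k * y ^ (?q - k)) = 0"
    by (intro sum.neutral) auto
  then show ?thesis
    by (simp add: binomial_ring q add_ac)
qed

text \<open>Applied with \<open>U, V, W\<close> the \<open>q\<close>-th powers of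
  \<open>u, v, w\<close> and \<open>\<kappa>\<close> that of \<open>\<mu>\<close>. For
  \<open>a\<close> and \<open>b\<close> as in the proof, both \<open>\<kappa> * a\<close> and
  \<open>\<kappa> * b\<close> must equal \<open>- 3 * \<mu>\<close>, whereas
  \<open>a - b = - 3 * w * (u - v)\<close> is nonzero.\<close>

lemma frobenius_system_inconsistent:
  fixes u v w U V W :: "'a::idom"
  assumes "(3 :: 'a) \<noteq> 0" "\<kappa> \<noteq> 0"
    and nz: "w \<noteq> 0" "U \<noteq> 0" "V \<noteq> 0" and dist: "u \<noteq> v" "v \<noteq> w" "w \<noteq> u" "u \<noteq> 0" "v \<noteq> 0"
    and sums: "u + v + w = 0" "U + V + W = 0"
    and eqs: "\<kappa> * (u * U * (v - w)) = \<mu> * (V - W)"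
      "\<kappa> * (v * V * (w - u)) = \<mu> * (W - U)"
      "\<kappa> * (w * W * (u - v)) = \<mu> * (U - V)"
  shows False
proof -
  \<comment> \<open>Up to sign, these are the coefficients left in the sum \<open>?S\<close> below
    once one of \<open>U, V, W\<close> is eliminated.\<close>
  define a b c where "a = u\<^sup>2 + 2 * v * w" and "b = v\<^sup>2 + 2 * u * w" and "c = w\<^sup>2 + 2 * u * v"
  note abc = a_def b_def c_def
  have w: "w = - u - v" and W: "W = - U - V"
    using sums by (simp_all add: algebra_simps eq_neg_iff_add_eq_0)
  \<comment> \<open>The sum of the three equations and \<open>U + V + W = 0\<close> force \<open>(U, V, W)\<close> to be proportional to \<open>(a, b, c)\<close>.\<close>
  let ?S = "u * U * (v - w) + v * V * (w - u) + w * W * (u - v)"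
  have "\<kappa> * ?S = 0"
    by (simp only: distrib_left eqs) (simp add: algebra_simps)
  then have "?S = 0"
    using assms by simp
  moreover have "a * V - b * U = ?S" "c * U - a * W = ?S" "b * W - c * V = ?S"
    unfolding abc w W by (simp_all add: algebra_simps power2_eq_square)
  ultimately have UV: "a * V = b * U" and UW: "a * W = c * U" and VW: "b * W = c * V"
    by simp_all
  have diffs: "b - c = - 3 * u * (v - w)" "c - a = - 3 * v * (w - u)" "a - b = - 3 * w * (u - v)"
    unfolding abc w by (simp_all add: algebra_simps power2_eq_square)
  \<comment> \<open>Multiplied by \<open>a\<close>, the difference \<open>V - W\<close> becomes
    \<open>(b - c) * U\<close>, so both sides share the nonzero factor
    \<open>u * U * (v - w)\<close>.\<close>
  have "\<kappa> * a * (u * U * (v - w)) = a * (\<mu> * (V - W))"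
    by (simp only: eqs[symmetric] mult_ac)
  also have "\<dots> = \<mu> * (a * V - a * W)"
    by (simp add: algebra_simps)
  also have "\<dots> = \<mu> * ((b - c) * U)"
    by (simp only: UV UW left_diff_distrib)
  finally have "(\<kappa> * a + 3 * \<mu>) * (u * U * (v - w)) = 0"
    unfolding diffs by (simp add: algebra_simps)
  moreover have "(\<kappa> * b + 3 * \<mu>) * (v * V * (w - u)) = 0"
  proof -
    have "\<kappa> * b * (v * V * (w - u)) = b * (\<mu> * (W - U))"
      by (simp only: eqs[symmetric] mult_ac)
    also have "\<dots> = \<mu> * (b * W - b * U)"
      by (simp add: algebra_simps)
    also have "\<dots> = \<mu> * ((c - a) * V)"
      by (simp only: UV[symmetric] VW left_diff_distrib)
    finally show ?thesis
      unfolding diffs by (simp add: algebra_simps)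
  qed
  ultimately have "\<kappa> * a + 3 * \<mu> = 0" "\<kappa> * b + 3 * \<mu> = 0"
    using nz dist by simp_all
  then have "\<kappa> * a = \<kappa> * b"
    by (metis add_right_imp_eq)
  then show False
    using assms diffs(3) by simp
qed

text \<open>Cramer's rule: the equations are combined with the cofactors of the column of
  \<open>x\<close>.\<close>

lemma gradient_determinant:
  fixes x y z \<xi> \<eta> \<zeta> :: "'a::idom"
  assumes "(\<xi> + 2 * \<eta>) * y + (\<xi> + 2 * \<zeta>) * z = 0"
    and "(\<eta> + 2 * \<xi>) * x + (\<eta> + 2 * \<zeta>) * z = 0"
    and "(\<zeta> + 2 * \<xi>) * x + (\<zeta> + 2 * \<eta>) * y = 0"
  shows "6 * ((\<xi> + \<eta> + \<zeta>) * (\<xi> * \<eta> + \<eta> * \<zeta> + \<zeta> * \<xi>)) * x = 0"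
proof -
  have "6 * ((\<xi> + \<eta> + \<zeta>) * (\<xi> * \<eta> + \<eta> * \<zeta> + \<zeta> * \<xi>)) * x =
      (\<xi> + 2 * \<zeta>) * (\<zeta> + 2 * \<eta>) * ((\<eta> + 2 * \<xi>) * x + (\<eta> + 2 * \<zeta>) * z)
    + (\<xi> + 2 * \<eta>) * (\<eta> + 2 * \<zeta>) * ((\<zeta> + 2 * \<xi>) * x + (\<zeta> + 2 * \<eta>) * y)
    - (\<eta> + 2 * \<zeta>) * (\<zeta> + 2 * \<eta>) * ((\<xi> + 2 * \<eta>) * y + (\<xi> + 2 * \<zeta>) * z)"
    by (simp add: algebra_simps)
  then show ?thesis
    by (simp only: assms mult_zero_right add_0_left diff_self)
qed

text \<open>Used cyclically, this gives the three coordinates a common value \<open>l\<close>.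
  Modulo the relation \<open>s\<close>, the cleared difference of the two sides is
  \<open>- \<xi> * \<eta>\<close> times the equation \<open>e\<close>.\<close>

lemma gradient_ratio:
  fixes x y \<xi> \<eta> \<zeta> :: "'a::field"
  assumes nz: "\<xi> \<noteq> 0" "\<eta> \<noteq> 0" "\<zeta> \<noteq> 0"
    and s: "\<xi> * \<eta> + \<eta> * \<zeta> + \<zeta> * \<xi> = 0"
    and e: "(\<zeta> + 2 * \<xi>) * x + (\<zeta> + 2 * \<eta>) * y = 0"
  shows "x * \<xi> * (inverse \<eta> - inverse \<zeta>) = y * \<eta> * (inverse \<zeta> - inverse \<xi>)"
proof -
  have "x * \<xi>\<^sup>2 * (\<zeta> - \<eta>) - y * \<eta>\<^sup>2 * (\<xi> - \<zeta>) =
      (x * \<xi> + y * \<eta>) * (\<xi> * \<eta> + \<eta> * \<zeta> + \<zeta> * \<xi>) - \<xi> * \<eta> * ((\<zeta> + 2 * \<xi>) * x + (\<zeta> + 2 * \<eta>) * y)"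
    by (simp add: algebra_simps power2_eq_square)
  then have "x * \<xi>\<^sup>2 * (\<zeta> - \<eta>) = y * \<eta>\<^sup>2 * (\<xi> - \<zeta>)"
    by (simp add: s e)
  moreover have "x * \<xi> * (inverse \<eta> - inverse \<zeta>) = x * \<xi>\<^sup>2 * (\<zeta> - \<eta>) / (\<xi> * \<eta> * \<zeta>)"
    "y * \<eta> * (inverse \<zeta> - inverse \<xi>) = y * \<eta>\<^sup>2 * (\<xi> - \<zeta>) / (\<xi> * \<eta> * \<zeta>)"
    using nz by (simp_all add: field_simps power2_eq_square)
  ultimately show ?thesis
    by simp
qed

lemma gradient_system_trivial:
  fixes x y z :: "'a::field"
  assumes char: "(2 :: 'a) \<noteq> 0" "(3 :: 'a) \<noteq> 0" and "e > 0"
    and frobenius: "\<And>a b :: 'a. (a + b) ^ (2 * e + 1) = a ^ (2 * e + 1) + b ^ (2 * e + 1)"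
    and eqs: "(x ^ e + 2 * y ^ e) * y + (x ^ e + 2 * z ^ e) * z = 0"
      "(y ^ e + 2 * x ^ e) * x + (y ^ e + 2 * z ^ e) * z = 0"
      "(z ^ e + 2 * x ^ e) * x + (z ^ e + 2 * y ^ e) * y = 0"
  shows "x = 0 \<and> y = 0 \<and> z = 0"
proof (rule ccontr)
  assume nontriv: "\<not> ?thesis"
  define \<xi> \<eta> \<zeta> where "\<xi> = x ^ e" and "\<eta> = y ^ e" and "\<zeta> = z ^ e"
  note eqs = eqs[folded \<xi>_def \<eta>_def \<zeta>_def]
  have zero_iff: "\<xi> = 0 \<longleftrightarrow> x = 0" "\<eta> = 0 \<longleftrightarrow> y = 0" "\<zeta> = 0 \<longleftrightarrow> z = 0"
    using \<open>e > 0\<close> by (simp_all add: \<xi>_def \<eta>_def \<zeta>_def)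
  have "(6 :: 'a) \<noteq> 0"
  proof -
    have "(6 :: 'a) = 2 * 3" by simp
    then show ?thesis using char by (metis mult_eq_0_iff)
  qed
  moreover have "6 * ((\<xi> + \<eta> + \<zeta>) * (\<xi> * \<eta> + \<eta> * \<zeta> + \<zeta> * \<xi>)) * x = 0"
    "6 * ((\<xi> + \<eta> + \<zeta>) * (\<xi> * \<eta> + \<eta> * \<zeta> + \<zeta> * \<xi>)) * y = 0"
    "6 * ((\<xi> + \<eta> + \<zeta>) * (\<xi> * \<eta> + \<eta> * \<zeta> + \<zeta> * \<xi>)) * z = 0"
    using gradient_determinant[of \<xi> \<eta> y \<zeta> z x] gradient_determinant[of \<eta> \<xi> x \<zeta> z y]
      gradient_determinant[of \<zeta> \<xi> x \<eta> y z] eqs by (simp_all add: algebra_simps)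
  ultimately consider "\<xi> + \<eta> + \<zeta> = 0" | "\<xi> * \<eta> + \<eta> * \<zeta> + \<zeta> * \<xi> = 0"
    using nontriv by auto
  then show False
  proof cases
    case 1
    have coeffs: "\<xi> + 2 * \<eta> = \<eta> - \<zeta>" "\<xi> + 2 * \<zeta> = \<zeta> - \<eta>" "\<eta> + 2 * \<xi> = \<xi> - \<zeta>" "\<eta> + 2 * \<zeta> = \<zeta> - \<xi>"
      using 1 by (simp_all add: algebra_simps add_eq_0_iff)
    have "(\<eta> - \<zeta>) * y + (\<zeta> - \<eta>) * z = 0" "(\<xi> - \<zeta>) * x + (\<zeta> - \<xi>) * z = 0"
      using eqs(1,2) unfolding coeffs .
    then have "(\<eta> - \<zeta>) * (y - z) = 0" "(\<xi> - \<zeta>) * (x - z) = 0"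
      by (simp_all add: algebra_simps)
    \<comment> \<open>If instead the factor \<open>y - z\<close> is zero, the \<open>e\<close>-th
      powers agree as well; likewise for \<open>x - z\<close>.\<close>
    then have "\<eta> = \<zeta>" "\<xi> = \<zeta>"
      by (auto simp: \<xi>_def \<eta>_def \<zeta>_def)
    then have "3 * \<zeta> = 0"
      using 1 by simp
    then have "\<zeta> = 0"
      using char by simp
    then show False
      using \<open>\<eta> = \<zeta>\<close> \<open>\<xi> = \<zeta>\<close> zero_iff nontriv by simp
  next
    case 2
    \<comment> \<open>If one of them is zero, so is a second one by the case assumption, and a
      gradient equation then kills the third.\<close>
    have nz: "\<xi> \<noteq> 0" "\<eta> \<noteq> 0" "\<zeta> \<noteq> 0"
      using 2 eqs char nontriv zero_iff by auto
    have dist: "\<xi> \<noteq> \<eta>" "\<eta> \<noteq> \<zeta>" "\<zeta> \<noteq> \<xi>"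
    proof -
      \<comment> \<open>With two values equal to \<open>A\<close> and the third \<open>B\<close>,
        the case assumption gives \<open>A + 2 * B = 0\<close>, and the gradient equation shrinks to
        \<open>3 * A * a = 0\<close>.\<close>
      have no: False
        if "A * A + A * B + B * A = 0" "(A + 2 * B) * b + (A + 2 * A) * a = 0" "A \<noteq> 0" "a \<noteq> 0"
        for a b A B :: 'a
      proof -
        have "A * (A + 2 * B) = 0"
          using that by (simp add: algebra_simps)
        then show False
          using that char by simp
      qed
      show "\<xi> \<noteq> \<eta>" using no[of \<xi> \<zeta> z x] 2 eqs nz zero_iff by (auto simp: algebra_simps)
      show "\<eta> \<noteq> \<zeta>" using no[of \<eta> \<xi> x y] 2 eqs nz zero_iff by (auto simp: algebra_simps)
      show "\<zeta> \<noteq> \<xi>" using no[of \<zeta> \<eta> y z] 2 eqs nz zero_iff by (auto simp: algebra_simps)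
    qed
    let ?q = "2 * e + 1"
    define u v w where "u = inverse \<xi>" and "v = inverse \<eta>" and "w = inverse \<zeta>"
    define l where "l = x * \<xi> * (v - w)"
    have sum': "\<eta> * \<zeta> + \<zeta> * \<xi> + \<xi> * \<eta> = 0"
      using 2 by (simp only: add_ac)
    have l: "l = y * \<eta> * (w - u)" "l = z * \<zeta> * (u - v)"
      using gradient_ratio[OF nz 2 eqs(3)] gradient_ratio[OF nz(2,3,1) sum' eqs(1)]
      by (simp_all add: l_def u_def v_def w_def)
    have diff: "(a - b) ^ ?q = a ^ ?q - b ^ ?q" for a b :: 'a
      using frobenius[of "a - b" b] by simp
    \<comment> \<open>Take \<open>q\<close>-th powers in \<open>l = a * a ^ e * (b - c)\<close> and
      use that \<open>a\<close> to the \<open>q\<close> is \<open>a * a ^ e * a ^ e\<close>. The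
      factors on the left are chosen so that \<open>l\<close> itself reappears on the right and
      \<open>a\<close> enters only through \<open>inverse (a ^ e)\<close>.\<close>
    have key: "l ^ ?q * (inverse (a ^ e) * inverse (a ^ e) ^ ?q * (b - c)) = l * (b ^ ?q - c ^ ?q)"
      if "l = a * a ^ e * (b - c)" "a \<noteq> 0" for a b c :: 'a
    proof -
      have "a ^ ?q = a * a ^ e * a ^ e"
        by (simp add: mult_2 power_add)
      then have q: "a ^ ?q * inverse (a ^ e) = a * a ^ e"
        using that(2) by simp
      have one: "(a ^ e) ^ ?q * inverse (a ^ e) ^ ?q = 1"
        using that(2) by (metis power_mult_distrib power_one right_inverse power_not_zero)
      have "l ^ ?q = a ^ ?q * (a ^ e) ^ ?q * (b ^ ?q - c ^ ?q)"
        unfolding that(1) by (simp only: power_mult_distrib diff)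
      then have "l ^ ?q * (inverse (a ^ e) * inverse (a ^ e) ^ ?q * (b - c)) =
          (a ^ ?q * inverse (a ^ e)) * ((a ^ e) ^ ?q * inverse (a ^ e) ^ ?q) * (b - c) * (b ^ ?q - c ^ ?q)"
        by (simp only: mult_ac)
      then show ?thesis
        by (simp only: q one that(1) mult_1_right)
    qed
    have sum: "u + v + w = 0"
      using nz 2 by (simp add: u_def v_def w_def field_simps)
    then have "u ^ ?q + v ^ ?q + w ^ ?q = 0"
      by (simp only: frobenius[symmetric]) simp
    moreover have "l \<noteq> 0"
      using dist nz zero_iff by (simp add: l_def v_def w_def)
    ultimately show False
      using frobenius_system_inconsistent[of "l ^ ?q" w "u ^ ?q" "v ^ ?q" u v "w ^ ?q" l]
        key[of x v w] key[of y w u] key[of z u v] l l_def sum dist nz zero_iff char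
      unfolding \<xi>_def[symmetric] \<eta>_def[symmetric] \<zeta>_def[symmetric] u_def[symmetric]
        v_def[symmetric] w_def[symmetric]
      by (simp add: u_def v_def w_def)
  qed
qed

section \<open>Singular points of the curve over the closure\<close>

lemma smooth_triangle_curve:
  assumes card: "CARD('a::finite_field) = 2 * e + 1" and "e > 0" and char: "CHAR('a) > 3"
  shows "smooth_curve (triangle_poly (e + 1) :: 'a poly3)"
proof (rule smooth_curveI, rule ccontr)
  fix v :: "'a alg_closure ^ 3"
  assume "v \<noteq> 0" and "\<nexists>i. eval3 (pderiv3 i (ac_poly3 (triangle_poly (e + 1)))) v \<noteq> 0"
  then have sing: "eval3 (pderiv3 i (triangle_poly (e + 1))) v = 0" for i
    by (simp add: ac_triangle_poly)
  have small: "of_nat n \<noteq> (0 :: 'a alg_closure)" if "0 < n" "n \<le> 3" for n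
    using that char by (auto simp: of_nat_eq_0_iff_char_dvd dest!: dvd_imp_le)
  \<comment> \<open>The characteristic divides \<open>q\<close>, so
    \<open>q + 1 = 2 * (e + 1)\<close> becomes \<open>1\<close>.\<close>
  have "of_nat (2 * e + 1) = (0 :: 'a alg_closure)"
    using CHAR_dvd_CARD[where ?'a = 'a] by (simp only: of_nat_eq_0_iff_char_dvd CHAR_alg_closure card)
  then have half: "2 * of_nat (e + 1) = (1 :: 'a alg_closure)"
    by (simp add: algebra_simps)
  \<comment> \<open>Doubling a partial derivative removes its coefficient \<open>e + 1\<close>,
    which is one half.\<close>
  have clear: "x ^ e * (y + z) + 2 * (y ^ (e + 1) + z ^ (e + 1)) = 0"
    if "of_nat (e + 1) * x ^ e * (y + z) + y ^ (e + 1) + z ^ (e + 1) = 0"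
    for x y z :: "'a alg_closure"
  proof -
    have "(2 * of_nat (e + 1)) * x ^ e * (y + z) + 2 * (y ^ (e + 1) + z ^ (e + 1)) =
        2 * (of_nat (e + 1) * x ^ e * (y + z) + y ^ (e + 1) + z ^ (e + 1))"
      by (simp only: distrib_left mult.assoc add.assoc)
    then show ?thesis
      by (simp only: half that mult_1_left mult_zero_right)
  qed
  have "e + 1 > 0"
    by simp
  note partials = sing[of 1] sing[of 2] sing[of 3]
  note partials = partials[unfolded eval_pderiv_triangle_poly[OF \<open>e + 1 > 0\<close>] add_diff_cancel_right']
  have "v $ 1 = 0 \<and> v $ 2 = 0 \<and> v $ 3 = 0"
  proof (rule gradient_system_trivial)
    show "(2 :: 'a alg_closure) \<noteq> 0" "(3 :: 'a alg_closure) \<noteq> 0"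
      using small[of 2] small[of 3] by simp_all
    show "(a + b) ^ (2 * e + 1) = a ^ (2 * e + 1) + b ^ (2 * e + 1)" for a b :: "'a alg_closure"
      using power_card_add[where ?'a = 'a, of a b] by (simp only: CHAR_alg_closure card)
  qed (use partials[THEN clear] \<open>e > 0\<close> in \<open>simp_all add: algebra_simps\<close>)
  then show False
    using \<open>v \<noteq> 0\<close> by (simp add: vec_eq_iff forall_3)
qed

lemma projective_triangle_subset_curve:
  assumes "odd e" "CARD('a::finite_field) = 2 * e + 1"
  shows "projective_triangle \<subseteq> curve_points (triangle_poly (e + 1) :: 'a poly3)"
proof -
  have "proj_point x y z \<in> curve_points (triangle_poly (e + 1))"
    if "triangle_form (e + 1) x y z = 0" "(x, y, z) \<noteq> (0, 0, 0)" for x y z :: 'a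
    unfolding proj_point_def using that
    by (subst proj_class_in_curve_points_iff[OF homogeneous_triangle_poly])
      (auto simp: eval_triangle_poly vec_eq_iff forall_3)
  moreover have "triangle_form (e + 1) 0 1 (- s\<^sup>2) = 0" "triangle_form (e + 1) 1 (- s\<^sup>2) 0 = 0"
    "triangle_form (e + 1) (- s\<^sup>2) 0 1 = 0" for s :: 'a
    using triangle_form_minus_square[OF assms, of s]
    by (simp_all only: triangle_form_rotate[of _ 0] triangle_form_rotate[of _ "- s\<^sup>2"])
  ultimately show ?thesis
    by (auto simp: projective_triangle_def)
qed

theorem theorem5p1:
  fixes q :: nat
  assumes q: "q = CARD('a::finite_field)"
    and q_mod: "[q = 3] (mod 4)"
    and char: "CHAR('a) > 3"
  shows "\<exists>F :: 'a poly3.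
           plane_curve ((q + 3) div 2) F \<and> smooth_curve F \<and>
           nontrivial_blocking_set (curve_points F) \<and>
           projective_triangle \<subseteq> curve_points F"
proof -
  define e where "e = (q - 1) div 2"
  have "q mod 4 = 3"
    using q_mod by (simp add: cong_def)
  \<comment> \<open>Writing \<open>q = 4 * k + 3\<close> gives \<open>e = 2 * k + 1\<close>.\<close>
  then have card: "CARD('a) = 2 * e + 1" and "odd e" and degree: "(q + 3) div 2 = Suc (e + 1)"
    unfolding e_def q[symmetric] by presburger+
  have small: "of_nat n \<noteq> (0 :: 'a)" if "0 < n" "n \<le> 3" for n
    using that char by (auto simp: of_nat_eq_0_iff_char_dvd dest!: dvd_imp_le)
  have nz: "(2 :: 'a) \<noteq> 0" "(3 :: 'a) \<noteq> 0"
    using small[of 2] small[of 3] by simp_all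
  let ?F = "triangle_poly (e + 1) :: 'a poly3"
  have hom: "homogeneous3 (Suc (e + 1)) ?F"
    by (rule homogeneous_triangle_poly)
  have nonzero_on_line: "\<exists>v. v \<noteq> 0 \<and> (\<Sum>i\<in>UNIV. a $ i * v $ i) = 0 \<and> eval3 ?F v \<noteq> 0" for a
  proof -
    obtain x y z where "a $ 1 * x + a $ 2 * y + a $ 3 * z = 0" "triangle_form (e + 1) x y z \<noteq> 0"
      using triangle_form_nonzero_on_line[OF \<open>odd e\<close> card nz] by blast
    \<comment> \<open>The vector is nonzero because the form vanishes at the origin.\<close>
    then show ?thesis
      by (intro exI[of _ "vector [x, y, z]"])
        (auto simp: vec_eq_iff forall_3 sum_3 eval_triangle_poly triangle_form_0)
  qed
  have zero_on_line: "\<exists>v. v \<noteq> 0 \<and> (\<Sum>i\<in>UNIV. a $ i * v $ i) = 0 \<and> eval3 ?F v = 0" for a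
  proof -
    obtain x y z where "(x, y, z) \<noteq> (0, 0, 0)" "a $ 1 * x + a $ 2 * y + a $ 3 * z = 0"
      "triangle_form (e + 1) x y z = 0"
      by (rule triangle_form_zero_on_line[OF \<open>odd e\<close> card nz])
    then show ?thesis
      by (intro exI[of _ "vector [x, y, z]"])
        (auto simp: vec_eq_iff forall_3 sum_3 eval_triangle_poly)
  qed
  \<comment> \<open>For \<open>a = 0\<close> the linear condition is void, and what remains is a
    vector with nonzero value.\<close>
  have "?F \<noteq> 0"
    using nonzero_on_line[of 0] by force
  then have "plane_curve ((q + 3) div 2) ?F"
    using hom by (simp add: plane_curve_def degree)
  moreover have "smooth_curve ?F"
    using card char \<open>odd e\<close> by (intro smooth_triangle_curve odd_pos)
  moreover have "nontrivial_blocking_set (curve_points ?F)"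
    using hom zero_on_line nonzero_on_line by (rule nontrivial_blocking_set_curve_pointsI)
  moreover have "projective_triangle \<subseteq> curve_points ?F"
    using \<open>odd e\<close> card by (rule projective_triangle_subset_curve)
  ultimately show ?thesis
    by blast
qed

end
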